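(* Let $T$ be a traffic matrix, and suppose $\bar c_{ij}=\bar c_{ji}=\bar c_e$ for every edge $e=\{i,j\}\in E$. If the inequality $\pi x+\beta^1 y^1+\beta^2 y^2\ge \pi_o$ is valid for $D(T)$ (i.e. satisfied by all its points), then the inequality $\pi x+(\beta^1+\beta^2)y\ge \pi_o$ is valid for $B(T)$. Here $\pi\in\mathbb{R}^{A\times K}$, $\beta^1,\beta^2\in\mathbb{R}^{M\times E}$ and $\pi_o\in\mathbb{R}$.
   Context: $G=(N,E)$ is a finite undirected graph with edges $\{i,j\}$, $i\neq j$, whose node set is totally ordered; $A$ is the arc set containing both arcs $(ij)$ and $(ji)$ for each edge $\{i,j\}\in E$. $M$ is a finite set of facility types; a unit of facility $m\in M$ provides capacity $c_m\in\mathbb{Z}$, with $c_1<c_2<\dots<c_{|M|}$. Existing capacities are $\bar c_e$, $e\in E$, in the bidirected model and $\bar c_{ij}$, $(ij)\in A$, in the directed model (real numbers). $K=\{(ij)\in N\times N : i\neq j\}$ is the set of commodities. A traffic matrix is a matrix $T=\{t_{ij}\}_{i,j\in N}$ with $t_{ij}\ge 0$. For $k=(ij)\in K$ and $u\in N$, let $d_u^k=t_{ij}$ if $u=j$, $d_u^k=-t_{ij}$ if $u=i$, and $d_u^k=0$ otherwise. Flow variables are $x=(x_{ij}^k)\in\mathbb{R}^{A\times K}$. The flow balance constraints for $T$ are $$\sum_{j:(ij)\in A} x_{ij}^k-\sum_{j:(ji)\in A}x_{ji}^k=d_i^k\quad\text{for all } k\in K,\ i\in N.$$ $B(T)$ (bidirected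 capacity model) is the set of $(x,y)$ with $x\ge 0$, $y\ge 0$, $y\in\mathbb{Z}^{M\times E}$ satisfying the flow balance constraints for $T$ and $$\max\Big\{\sum_{k\in K}x_{ij}^k,\ \sum_{k\in K}x_{ji}^k\Big\}\le \bar c_e+\sum_{m\in M}c_m y_{m,e}\quad\text{for all } e=\{i,j\}\in E.$$ $D(T)$ (directed capacity model) is the set of $(x,y)$ with $x\ge 0$, $y\ge 0$, $y\in\mathbb{Z}^{M\times A}$ satisfying the flow balance constraints for $T$ and $$\sum_{k\in K}x_{ij}^k\le \bar c_{ij}+\sum_{m\in M}c_m y_{m,ij}\quad\text{for all } (ij)\in A.$$ For $y\in\mathbb{R}^{M\times A}$, $y^1$ is the vector of capacity variables on arcs $(ij)$ with $i<j$ and $y^2$ the vector of capacity variables on arcs $(ij)$ with $i>j$; both are indexed by $M\times E$ through the edge $\{i,j\}$ underlying each arc. *)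

theory Defs
  imports "HOL-Analysis.Analysis" "HOL-Library.FuncSet"
begin

definition undirected_graph :: "'n set \<Rightarrow> 'n set set \<Rightarrow> bool" where
  "undirected_graph N E \<longleftrightarrow>
     finite N \<and> (\<forall>e\<in>E. \<exists>i\<in>N. \<exists>j\<in>N. i \<noteq> j \<and> e = {i, j})"

definition arcs :: "'n set set \<Rightarrow> ('n \<times> 'n) set" where
  "arcs E = {(i, j). {i, j} \<in> E}"

definition commodities :: "'n set \<Rightarrow> ('n \<times> 'n) set" where
  "commodities N = {(i, j). i \<in> N \<and> j \<in> N \<and> i \<noteq> j}"

definition traffic_matrix :: "'n set \<Rightarrow> ('n \<Rightarrow> 'n \<Rightarrow> real) \<Rightarrow> bool" where
  "traffic_matrix N T \<longleftrightarrow> (\<forall>i\<in>N. \<forall>j\<in>N. T i j \<ge> 0)"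

definition demand :: "('n \<Rightarrow> 'n \<Rightarrow> real) \<Rightarrow> 'n \<times> 'n \<Rightarrow> 'n \<Rightarrow> real" where
  "demand T k u =
     (if u = snd k then T (fst k) (snd k)
      else if u = fst k then - T (fst k) (snd k)
      else 0)"

text \<open>A flow variable with upper index \<open>k\<close> and lower index \<open>(i, j)\<close> is \<open>x ((i, j), k)\<close>.
  The balance is outflow minus inflow, so under the sign convention of \<open>demand\<close> the flow of
  commodity \<open>(i, j)\<close> leaves \<open>j\<close> and enters \<open>i\<close>.\<close>

definition flow_balance ::
  "'n set \<Rightarrow> 'n set set \<Rightarrow> ('n \<Rightarrow> 'n \<Rightarrow> real) \<Rightarrow> (('n \<times> 'n) \<times> ('n \<times> 'n) \<Rightarrow> real) \<Rightarrow> bool" where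
  "flow_balance N E T x \<longleftrightarrow>
     (\<forall>k\<in>commodities N. \<forall>i\<in>N.
        (\<Sum>j | (i, j) \<in> arcs E. x ((i, j), k)) - (\<Sum>j | (j, i) \<in> arcs E. x ((j, i), k))
          = demand T k i)"

text \<open>A vector indexed by a finite set \<open>I\<close> is an extensional function on \<open>I\<close>; integral
  capacity variables are real numbers in \<open>\<int>\<close>.\<close>

definition bidirected_model ::
  "'n set \<Rightarrow> 'n set set \<Rightarrow> 'm set \<Rightarrow> ('m \<Rightarrow> int) \<Rightarrow> ('n set \<Rightarrow> real) \<Rightarrow> ('n \<Rightarrow> 'n \<Rightarrow> real)
     \<Rightarrow> ((('n \<times> 'n) \<times> ('n \<times> 'n) \<Rightarrow> real) \<times> ('m \<times> 'n set \<Rightarrow> real)) set" where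
  "bidirected_model N E M c cbar T =
     {(x, y).
        x \<in> arcs E \<times> commodities N \<rightarrow>\<^sub>E {0..} \<and>
        y \<in> M \<times> E \<rightarrow>\<^sub>E {r. r \<in> \<int> \<and> r \<ge> 0} \<and>
        flow_balance N E T x \<and>
        (\<forall>i j. {i, j} \<in> E \<longrightarrow>
           max (\<Sum>k\<in>commodities N. x ((i, j), k)) (\<Sum>k\<in>commodities N. x ((j, i), k))
             \<le> cbar {i, j} + (\<Sum>m\<in>M. of_int (c m) * y (m, {i, j})))}"

definition directed_model ::
  "'n set \<Rightarrow> 'n set set \<Rightarrow> 'm set \<Rightarrow> ('m \<Rightarrow> int) \<Rightarrow> ('n \<times> 'n \<Rightarrow> real) \<Rightarrow> ('n \<Rightarrow> 'n \<Rightarrow> real)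
     \<Rightarrow> ((('n \<times> 'n) \<times> ('n \<times> 'n) \<Rightarrow> real) \<times> ('m \<times> ('n \<times> 'n) \<Rightarrow> real)) set" where
  "directed_model N E M c cbar T =
     {(x, y).
        x \<in> arcs E \<times> commodities N \<rightarrow>\<^sub>E {0..} \<and>
        y \<in> M \<times> arcs E \<rightarrow>\<^sub>E {r. r \<in> \<int> \<and> r \<ge> 0} \<and>
        flow_balance N E T x \<and>
        (\<forall>(i, j)\<in>arcs E.
           (\<Sum>k\<in>commodities N. x ((i, j), k))
             \<le> cbar (i, j) + (\<Sum>m\<in>M. of_int (c m) * y (m, (i, j))))}"

text \<open>For an edge \<open>e = {i, j}\<close> with \<open>i < j\<close>, \<open>(Min e, Max e)\<close> is the arc \<open>(i, j)\<close> and
  \<open>(Max e, Min e)\<close> the arc \<open>(j, i)\<close>.\<close>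

definition forward_part :: "('m \<times> ('n::linorder \<times> 'n) \<Rightarrow> real) \<Rightarrow> 'm \<times> 'n set \<Rightarrow> real" where
  "forward_part y = (\<lambda>(m, e). y (m, (Min e, Max e)))"

definition backward_part :: "('m \<times> ('n::linorder \<times> 'n) \<Rightarrow> real) \<Rightarrow> 'm \<times> 'n set \<Rightarrow> real" where
  "backward_part y = (\<lambda>(m, e). y (m, (Max e, Min e)))"

definition inner_on :: "'i set \<Rightarrow> ('i \<Rightarrow> real) \<Rightarrow> ('i \<Rightarrow> real) \<Rightarrow> real" where
  "inner_on I a v = (\<Sum>i\<in>I. a i * v i)"

definition valid_inequality :: "('p \<Rightarrow> real) \<Rightarrow> real \<Rightarrow> 'p set \<Rightarrow> bool" where
  "valid_inequality lhs rhs S \<longleftrightarrow> (\<forall>p\<in>S. lhs p \<ge> rhs)"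

end

theory Submission
  imports Defs
begin

text \<open>Giving both arcs of every edge the capacity installed on the edge turns a point of the
  bidirected model into a point of the directed model with \<open>y\<^sup>1 = y\<^sup>2 = y\<close>.\<close>

definition both_arcs :: "'m set \<Rightarrow> 'n set set \<Rightarrow> ('m \<times> 'n set \<Rightarrow> real) \<Rightarrow> 'm \<times> ('n \<times> 'n) \<Rightarrow> real" where
  "both_arcs M E y = (\<lambda>(m, (i, j))\<in>M \<times> arcs E. y (m, {i, j}))"

lemma both_arcs_apply:
  assumes "m \<in> M" "{i, j} \<in> E"
  shows "both_arcs M E y (m, (i, j)) = y (m, {i, j})"
  using assms by (simp add: both_arcs_def arcs_def)

text \<open>An edge consists of two nodes, which are its minimum and maximum in some order. So the
  arcs that \<open>forward_part\<close> and \<open>backward_part\<close> evaluate at are the two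
  orientations of \<open>e\<close>.\<close>

lemma edge_Min_Max:
  fixes E :: "'n::linorder set set"
  assumes "undirected_graph N E" "e \<in> E"
  shows "{Min e, Max e} = e"
proof -
  obtain i j where "e = {i, j}"
    using assms unfolding undirected_graph_def by blast
  then show ?thesis
    by (auto simp: min_def max_def)
qed

lemma forward_part_both_arcs:
  fixes E :: "'n::linorder set set"
  assumes "undirected_graph N E" "m \<in> M" "e \<in> E"
  shows "forward_part (both_arcs M E y) (m, e) = y (m, e)"
  using assms edge_Min_Max[OF assms(1,3)] both_arcs_apply[of m M "Min e" "Max e" E y]
  by (simp add: forward_part_def)

text \<open>Reversing an arc leaves its underlying edge unchanged, so \<open>both_arcs\<close> reads
  the same entry of \<open>y\<close> as in the forward case; \<open>insert_commute\<close>
  identifies the two ways of writing that edge.\<close>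

lemma backward_part_both_arcs:
  fixes E :: "'n::linorder set set"
  assumes "undirected_graph N E" "m \<in> M" "e \<in> E"
  shows "backward_part (both_arcs M E y) (m, e) = y (m, e)"
  using assms edge_Min_Max[OF assms(1,3)] both_arcs_apply[of m M "Max e" "Min e" E y]
  by (simp add: backward_part_def insert_commute)

text \<open>The flow \<open>x\<close> is kept, so flow balance and nonnegativity of \<open>x\<close>
  carry over. On each arc the directed capacity equals that of its edge, which bounds the flow in
  both directions.\<close>

lemma bidirected_imp_directed:
  assumes cbar: "\<And>i j. {i, j} \<in> E \<Longrightarrow> cbar_arc (i, j) = cbar_edge {i, j}"
    and xy: "(x, y) \<in> bidirected_model N E M c cbar_edge T"
  shows "(x, both_arcs M E y) \<in> directed_model N E M c cbar_arc T"
proof -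
  have y: "y \<in> M \<times> E \<rightarrow>\<^sub>E {r. r \<in> \<int> \<and> r \<ge> 0}"
    \<comment> \<open>Only the first argument of the maximum is retained. Since \<open>i\<close> and
      \<open>j\<close> range over ordered pairs, the bound for the opposite arc is the instance with
      the two exchanged.\<close>
    and cap: "\<And>i j. {i, j} \<in> E \<Longrightarrow> (\<Sum>k\<in>commodities N. x ((i, j), k))
            \<le> cbar_edge {i, j} + (\<Sum>m\<in>M. of_int (c m) * y (m, {i, j}))"
    using xy by (auto simp: bidirected_model_def)
  \<comment> \<open>Integrality and sign are inherited from the edge entry; outside
    \<open>M \<times> arcs E\<close> the restricted abstraction gives \<open>undefined\<close>, as
    extensionality demands.\<close>
  have "both_arcs M E y \<in> M \<times> arcs E \<rightarrow>\<^sub>E {r. r \<in> \<int> \<and> r \<ge> 0}"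
    using PiE_mem[OF y] by (auto simp: both_arcs_def arcs_def)
  moreover have "(\<Sum>k\<in>commodities N. x ((i, j), k))
      \<le> cbar_arc (i, j) + (\<Sum>m\<in>M. of_int (c m) * both_arcs M E y (m, (i, j)))"
    if "(i, j) \<in> arcs E" for i j
    using that cap[of i j] cbar[of i j] by (simp add: arcs_def both_arcs_apply)
  ultimately show ?thesis
    using xy by (auto simp: bidirected_model_def directed_model_def)
qed


theorem proposition3:
  fixes N :: "'n::linorder set" and E :: "'n set set"
    and M :: "'m::linorder set" and c :: "'m \<Rightarrow> int"
    and cbar_edge :: "'n set \<Rightarrow> real" and cbar_arc :: "'n \<times> 'n \<Rightarrow> real"
    and T :: "'n \<Rightarrow> 'n \<Rightarrow> real"
    and \<pi> :: "('n \<times> 'n) \<times> ('n \<times> 'n) \<Rightarrow> real"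
    and \<beta>1 \<beta>2 :: "'m \<times> 'n set \<Rightarrow> real"
    and \<pi>\<^sub>o :: real
  assumes "undirected_graph N E"
    and "finite M" and "strict_mono_on M c"
    and "traffic_matrix N T"
    and "\<forall>i j. {i, j} \<in> E \<longrightarrow>
           cbar_arc (i, j) = cbar_edge {i, j} \<and> cbar_arc (j, i) = cbar_edge {i, j}"
    and "valid_inequality
           (\<lambda>(x, y). inner_on (arcs E \<times> commodities N) \<pi> x
              + inner_on (M \<times> E) \<beta>1 (forward_part y)
              + inner_on (M \<times> E) \<beta>2 (backward_part y))
           \<pi>\<^sub>o (directed_model N E M c cbar_arc T)"
  shows "valid_inequality
           (\<lambda>(x, y). inner_on (arcs E \<times> commodities N) \<pi> x
              + inner_on (M \<times> E) (\<lambda>q. \<beta>1 q + \<beta>2 q) y)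
           \<pi>\<^sub>o (bidirected_model N E M c cbar_edge T)"
proof -
  have "\<pi>\<^sub>o \<le> inner_on (arcs E \<times> commodities N) \<pi> x
      + inner_on (M \<times> E) (\<lambda>q. \<beta>1 q + \<beta>2 q) y"
    if "(x, y) \<in> bidirected_model N E M c cbar_edge T" for x y
  proof -
    have "(x, both_arcs M E y) \<in> directed_model N E M c cbar_arc T"
      using bidirected_imp_directed[OF _ that] assms(5) by blast
    then have "\<pi>\<^sub>o \<le> inner_on (arcs E \<times> commodities N) \<pi> x
        + inner_on (M \<times> E) \<beta>1 (forward_part (both_arcs M E y))
        + inner_on (M \<times> E) \<beta>2 (backward_part (both_arcs M E y))"
      using assms(6) by (auto simp: valid_inequality_def)
    \<comment> \<open>The sums see only indices in \<open>M \<times> E\<close>, where both parts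
      agree with \<open>y\<close>. Leaving \<beta> arbitrary lets these equations serve both
      \<open>\<beta>1\<close> and \<open>\<beta>2\<close>.\<close>
    moreover have "inner_on (M \<times> E) \<beta> (forward_part (both_arcs M E y)) = inner_on (M \<times> E) \<beta> y"
      and "inner_on (M \<times> E) \<beta> (backward_part (both_arcs M E y)) = inner_on (M \<times> E) \<beta> y" for \<beta>
      unfolding inner_on_def
      by (auto intro!: sum.cong simp: forward_part_both_arcs[OF assms(1)]
          backward_part_both_arcs[OF assms(1)])
    moreover have "inner_on (M \<times> E) (\<lambda>q. \<beta>1 q + \<beta>2 q) y
        = inner_on (M \<times> E) \<beta>1 y + inner_on (M \<times> E) \<beta>2 y"
      by (simp add: inner_on_def distrib_right sum.distrib)
    ultimately show ?thesis
      by simp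
  qed
  then show ?thesis
    by (auto simp: valid_inequality_def)
qed

end
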